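(* Let $L$ be a continuous conditionally-complete distributive lattice, let $E$ be a quasisober topological space with Borel $\sigma$-algebra $\mathcal{B}$, and let $\nu:\mathcal{B}\to L$ be an $L$-valued maxitive measure. If $\nu$ is outer-continuous, then the following are equivalent: (1) $\nu$ is the regular part of some $L$-valued maxitive measure on $\mathcal{B}$; (2) the singular part $\bot\nu$ of $\nu$ is identically $0$; (3) $\nu$ is regular.
   Context: Order theory. $\bigoplus$, $\oplus$ denote suprema, $\bigwedge$ infima. A lattice is a poset in which every nonempty finite subset has a supremum and an infimum; it is conditionally-complete if every nonempty subset bounded above has a supremum; it is distributive if finite infima distribute over finite suprema. A filter in a poset is a nonempty upper set $F$ in which any two elements have a lower bound in $F$. $s \gg r$ means: for every filter $F$ having an infimum, $r \geqslant \bigwedge F$ implies $s\in F$. A poset $L$ is continuous if for every $r\in L$ the set $\{s : s\gg r\}$ is a filter with infimum $r$. $L$ is assumed to have a bottom element $0$ (so every filter of $L$ has an infimum). Topology. $\mathcal{G}$ is the collection of open subsets of $E$. A subset is irreducible if it is nonempty and whenever it is contained in the union of two closed sets it is contained in one of them; $E$ is quasisober if every irreducible closed subset is the closure of a singleton. A subset is saturated if it is an intersection of open subsets; $\uparrow\! A$ is the intersection of all open subsets containing $A$. Compact does not require Hausdorff. $\mathcal{B}$ is the $\sigma$-algebra generated by the open subsets and the compact saturated subsets. $\mathcal{K}$ is the collection of compact subsets belonging to $\mathcal{B}$. Maxitive measures. A maxitive measure is a map $\nu:\mathcal{B}\to L$ with $\nu(\emptyset)=0$ and $\nu(B_1\cup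 B_2)=\nu(B_1)\oplus\nu(B_2)$ for all $B_1,B_2\in\mathcal{B}$. They are ordered pointwise and $\oplus$ of maps is pointwise. $\nu^{+}(B) := \bigwedge_{G\in\mathcal{G}, G\supset B}\nu(G)$ for $B\in\mathcal{B}$. $\nu$ is outer-continuous if $\nu(B)=\nu^{+}(B)$ for all $B\in\mathcal{B}$; inner-continuous if $\nu(B)=\bigoplus_{K\in\mathcal{K},K\subset B}\nu(\uparrow\! K)$ for all $B\in\mathcal{B}$; regular if both. The regular part of $\nu$ is $\lfloor\nu\rfloor(B) := \bigoplus_{K\in\mathcal{K}, K\subset B}\nu^{+}(K)$, $B\in\mathcal{B}$. The singular part $\bot\nu$ is the least $L$-valued maxitive measure on $\mathcal{B}$ such that $\nu^{+}=\lfloor\nu\rfloor\oplus\bot\nu$ (it exists under the present assumptions). *)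

theory Defs
  imports "HOL-Analysis.Analysis"
begin

section \<open>Continuous lattices\<close>

definition order_filter :: "'l::order set \<Rightarrow> bool" where
  "order_filter F \<longleftrightarrow>
     F \<noteq> {} \<and> (\<forall>x\<in>F. \<forall>y. x \<le> y \<longrightarrow> y \<in> F) \<and> (\<forall>x\<in>F. \<forall>y\<in>F. \<exists>z\<in>F. z \<le> x \<and> z \<le> y)"

text \<open>The relation \<open>s \<ggreater> r\<close>. Because of the least element every filter is nonempty and bounded
  below, so it has the infimum \<open>Inf F\<close> and no existence premise is needed.\<close>

definition way_above :: "'l::{conditionally_complete_lattice, order_bot} \<Rightarrow> 'l \<Rightarrow> bool" where
  "way_above s r \<longleftrightarrow> (\<forall>F. order_filter F \<longrightarrow> Inf F \<le> r \<longrightarrow> s \<in> F)"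

definition continuous_poset :: "'l::{conditionally_complete_lattice, order_bot} itself \<Rightarrow> bool" where
  "continuous_poset _ \<longleftrightarrow>
     (\<forall>r::'l. order_filter {s. way_above s r} \<and> Inf {s. way_above s r} = r)"


section \<open>Quasisober spaces, saturation and Borel sets\<close>

definition irreducible_in :: "'e topology \<Rightarrow> 'e set \<Rightarrow> bool" where
  "irreducible_in X C \<longleftrightarrow> C \<subseteq> topspace X \<and> C \<noteq> {} \<and>
     (\<forall>A B. closedin X A \<longrightarrow> closedin X B \<longrightarrow> C \<subseteq> A \<union> B \<longrightarrow> C \<subseteq> A \<or> C \<subseteq> B)"

definition quasisober :: "'e topology \<Rightarrow> bool" where
  "quasisober X \<longleftrightarrow>
     (\<forall>C. closedin X C \<longrightarrow> irreducible_in X C \<longrightarrow> (\<exists>x\<in>topspace X. C = X closure_of {x}))"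

text \<open>Intersecting with \<^term>\<open>topspace X\<close> makes the empty intersection the whole space.\<close>

definition saturated_in :: "'e topology \<Rightarrow> 'e set \<Rightarrow> bool" where
  "saturated_in X A \<longleftrightarrow> (\<exists>\<U>. (\<forall>U\<in>\<U>. openin X U) \<and> A = topspace X \<inter> \<Inter>\<U>)"

definition saturation :: "'e topology \<Rightarrow> 'e set \<Rightarrow> 'e set" where
  "saturation X A = \<Inter>{U. openin X U \<and> A \<subseteq> U}"

definition borel_sets :: "'e topology \<Rightarrow> 'e set set" where
  "borel_sets X = sigma_sets (topspace X)
     ({U. openin X U} \<union> {K. compactin X K \<and> saturated_in X K})"

definition compact_borel_sets :: "'e topology \<Rightarrow> 'e set set" where
  "compact_borel_sets X = {K \<in> borel_sets X. compactin X K}"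


section \<open>Maxitive measures\<close>

text \<open>A map on the Borel sets is represented by a total function on sets, of which only the values on
  \<^term>\<open>borel_sets X\<close> matter. For a maxitive measure all infima and suprema below are taken over
  nonempty sets lying between the least element and the value at the whole space, so they are
  genuine.\<close>

definition maxitive_measure ::
    "'e topology \<Rightarrow> ('e set \<Rightarrow> 'l::{lattice, order_bot}) \<Rightarrow> bool" where
  "maxitive_measure X \<nu> \<longleftrightarrow> \<nu> {} = bot \<and>
     (\<forall>A\<in>borel_sets X. \<forall>B\<in>borel_sets X. \<nu> (A \<union> B) = sup (\<nu> A) (\<nu> B))"

definition outer_part ::
    "'e topology \<Rightarrow> ('e set \<Rightarrow> 'l::conditionally_complete_lattice) \<Rightarrow> 'e set \<Rightarrow> 'l" where
  "outer_part X \<nu> B = (INF G\<in>{G. openin X G \<and> B \<subseteq> G}. \<nu> G)"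

definition outer_continuous ::
    "'e topology \<Rightarrow> ('e set \<Rightarrow> 'l::conditionally_complete_lattice) \<Rightarrow> bool" where
  "outer_continuous X \<nu> \<longleftrightarrow> (\<forall>B\<in>borel_sets X. \<nu> B = outer_part X \<nu> B)"

definition inner_continuous ::
    "'e topology \<Rightarrow> ('e set \<Rightarrow> 'l::conditionally_complete_lattice) \<Rightarrow> bool" where
  "inner_continuous X \<nu> \<longleftrightarrow> (\<forall>B\<in>borel_sets X.
     \<nu> B = (SUP K\<in>{K \<in> compact_borel_sets X. K \<subseteq> B}. \<nu> (saturation X K)))"

definition regular_measure ::
    "'e topology \<Rightarrow> ('e set \<Rightarrow> 'l::conditionally_complete_lattice) \<Rightarrow> bool" where
  "regular_measure X \<nu> \<longleftrightarrow> outer_continuous X \<nu> \<and> inner_continuous X \<nu>"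

definition regular_part ::
    "'e topology \<Rightarrow> ('e set \<Rightarrow> 'l::conditionally_complete_lattice) \<Rightarrow> 'e set \<Rightarrow> 'l" where
  "regular_part X \<nu> B = (SUP K\<in>{K \<in> compact_borel_sets X. K \<subseteq> B}. outer_part X \<nu> K)"

definition singular_complement :: "'e topology \<Rightarrow>
    ('e set \<Rightarrow> 'l::{conditionally_complete_lattice, order_bot}) \<Rightarrow> ('e set \<Rightarrow> 'l) \<Rightarrow> bool" where
  "singular_complement X \<nu> \<tau> \<longleftrightarrow> maxitive_measure X \<tau> \<and>
     (\<forall>B\<in>borel_sets X. outer_part X \<nu> B = sup (regular_part X \<nu> B) (\<tau> B))"

definition is_singular_part :: "'e topology \<Rightarrow>
    ('e set \<Rightarrow> 'l::{conditionally_complete_lattice, order_bot}) \<Rightarrow> ('e set \<Rightarrow> 'l) \<Rightarrow> bool" where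
  "is_singular_part X \<nu> \<tau> \<longleftrightarrow> singular_complement X \<nu> \<tau> \<and>
     (\<forall>\<sigma>. singular_complement X \<nu> \<sigma> \<longrightarrow> (\<forall>B\<in>borel_sets X. \<tau> B \<le> \<sigma> B))"

text \<open>A least element is determined only on the Borel sets (see the lemma below), hence the choice
  operator instead of a definite description.\<close>

definition singular_part :: "'e topology \<Rightarrow>
    ('e set \<Rightarrow> 'l::{conditionally_complete_lattice, order_bot}) \<Rightarrow> 'e set \<Rightarrow> 'l" where
  "singular_part X \<nu> = (SOME \<tau>. is_singular_part X \<nu> \<tau>)"

lemma singular_part_unique:
  assumes "is_singular_part X \<nu> \<tau>" "B \<in> borel_sets X"
  shows "singular_part X \<nu> B = \<tau> B"
proof -
  have "is_singular_part X \<nu> (singular_part X \<nu>)"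
    unfolding singular_part_def by (rule someI[of "is_singular_part X \<nu>", OF assms(1)])
  then show ?thesis
    using assms by (auto simp: is_singular_part_def intro: order.antisym)
qed

end

theory Submission
  imports Defs
begin

text \<open>Since \<open>\<nu>\<close> is outer-continuous, \<open>\<nu>\<close>, \<open>\<nu>\<^sup>+\<close> and \<open>\<nu>\<close> of the saturation agree on every compact
  Borel set, so \<open>\<nu>\<close> is regular iff it equals its own regular part. If \<open>\<nu>\<close> is the regular part of
  \<open>\<mu>\<close>, then \<open>\<nu>(K) \<ge> \<mu>\<^sup>+(K)\<close> for compact Borel \<open>K\<close>, and taking suprema shows that \<open>\<nu>\<close> equals its
  regular part.

  For the singular part, continuity and distributivity make \<open>L\<close> a co-Heyting algebra, with a
  difference \<open>a \<ominus> b\<close>, the least \<open>x\<close> such that \<open>a \<le> b \<oplus> x\<close>. The set function \<open>B \<mapsto> \<nu>(B) \<ominus> \<lambda>(B)\<close>, where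
  \<open>\<lambda>\<close> is the regular part, is finitely subadditive, so its monotone hull
  \<open>\<tau>(B) = \<Oplus>\<^bsub>C \<subseteq> B\<^esub> (\<nu>(C) \<ominus> \<lambda>(C))\<close> is maxitive and is the least complement of \<open>\<lambda>\<close> in \<open>\<nu>\<close>.
  Hence \<open>\<tau> = 0\<close> iff \<open>\<nu> = \<lambda>\<close>.\<close>

section \<open>Differences in continuous distributive lattices\<close>

lemma way_above_imp_le:
  fixes r s :: "'l::{conditionally_complete_lattice, order_bot}"
  assumes "way_above s r"
  shows "r \<le> s"
proof -
  have "order_filter {r..}"
    by (auto simp: order_filter_def intro: order_trans)
  then show ?thesis
    using assms by (auto simp: way_above_def)
qed

text \<open>The set contains \<open>a\<close> and is bounded below by \<open>bot\<close>, so the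
  infimum is genuine; that it is attained is the content of
  \<open>le_sup_lattice_diff\<close>.\<close>

definition lattice_diff :: "'l \<Rightarrow> 'l \<Rightarrow> 'l::{conditionally_complete_lattice, order_bot}" where
  "lattice_diff a b = Inf {x. a \<le> sup b x}"

lemma lattice_diff_le:
  fixes a b x :: "'l::{conditionally_complete_lattice, order_bot}"
  shows "a \<le> sup b x \<Longrightarrow> lattice_diff a b \<le> x"
  unfolding lattice_diff_def by (rule cInf_lower) auto

text \<open>Distributivity makes the set defining the difference a filter, so everything way above
  the right-hand side \<open>?r\<close> lies in it; by continuity \<open>?r\<close> is the infimum
  of such elements.\<close>

lemma le_sup_lattice_diff:
  fixes a b :: "'l::{conditionally_complete_lattice, distrib_lattice, order_bot}"
  assumes "continuous_poset TYPE('l)"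
  shows "a \<le> sup b (lattice_diff a b)"
proof -
  let ?F = "{x. a \<le> sup b x}"
  let ?r = "sup b (lattice_diff a b)"
  have "a \<in> ?F"
    by simp
  moreover have "inf x y \<in> ?F" if "x \<in> ?F" "y \<in> ?F" for x y
    using that by (simp add: sup_inf_distrib1)
  moreover have "y \<in> ?F" if "x \<in> ?F" "x \<le> y" for x y
  proof -
    have "sup b x \<le> sup b y"
      using that(2) by (rule sup_mono[OF order_refl])
    moreover have "a \<le> sup b x"
      using that(1) by simp
    ultimately have "a \<le> sup b y"
      by (rule order_trans[rotated])
    then show ?thesis
      by simp
  qed
  ultimately have F: "order_filter ?F"
    unfolding order_filter_def by (intro conjI ballI allI impI; blast intro: inf_le1 inf_le2)
  \<comment> \<open>Membership of \<open>s\<close> in \<open>?F\<close> gives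
    \<open>a \<le> sup b s\<close>, and \<open>sup b s\<close> collapses to \<open>s\<close> because
    \<open>b \<le> ?r \<le> s\<close>.\<close>
  have "a \<le> s" if "way_above s ?r" for s
  proof -
    have "Inf ?F \<le> ?r"
      by (simp add: lattice_diff_def)
    with F that have "a \<le> sup b s"
      by (auto simp: way_above_def)
    moreover have "b \<le> s"
      using way_above_imp_le[OF that] by simp
    ultimately show ?thesis
      by (simp add: sup_absorb2)
  qed
  moreover have "{s. way_above s ?r} \<noteq> {}" "Inf {s. way_above s ?r} = ?r"
    using assms by (auto simp: continuous_poset_def order_filter_def)
  ultimately show ?thesis
    using cInf_greatest[of "{s. way_above s ?r}" a] by simp
qed

text \<open>The co-Heyting adjunction; all later estimates of differences go through it.\<close>

lemma lattice_diff_le_iff: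
  fixes a b x :: "'l::{conditionally_complete_lattice, distrib_lattice, order_bot}"
  assumes "continuous_poset TYPE('l)"
  shows "lattice_diff a b \<le> x \<longleftrightarrow> a \<le> sup b x"
proof
  assume "lattice_diff a b \<le> x"
  then have "sup b (lattice_diff a b) \<le> sup b x"
    by (rule sup_mono[OF order_refl])
  with le_sup_lattice_diff[OF assms] show "a \<le> sup b x"
    by (rule order_trans)
qed (rule lattice_diff_le)

section \<open>Borel sets and saturation\<close>

lemma borel_sets_sigma_algebra: "sigma_algebra (topspace X) (borel_sets X)"
  unfolding borel_sets_def
  by (rule sigma_algebra_sigma_sets)
     (auto dest: openin_subset compactin_subset_topspace)

lemma openin_borel: "openin X U \<Longrightarrow> U \<in> borel_sets X"
  by (simp add: borel_sets_def sigma_sets.Basic)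

lemma borel_subset: "B \<in> borel_sets X \<Longrightarrow> B \<subseteq> topspace X"
  using borel_sets_sigma_algebra[of X] by (auto simp: sigma_algebra_iff2)

lemma borel_Int: "A \<in> borel_sets X \<Longrightarrow> B \<in> borel_sets X \<Longrightarrow> A \<inter> B \<in> borel_sets X"
  using borel_sets_sigma_algebra[of X] by (simp add: sigma_algebra_def algebra_iff_Int)

lemma empty_compact_borel: "{} \<in> compact_borel_sets X"
  by (simp add: compact_borel_sets_def openin_borel)

lemma subset_saturation: "K \<subseteq> saturation X K"
  by (auto simp: saturation_def)

lemma saturation_subset_open_iff: "openin X U \<Longrightarrow> saturation X K \<subseteq> U \<longleftrightarrow> K \<subseteq> U"
  by (auto simp: saturation_def)

text \<open>An open set contains \<open>K\<close> iff it contains the saturation, so compactness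
  passes to the saturation, which is then a generator of the Borel sets.\<close>

lemma saturation_compact_borel:
  assumes "compactin X K"
  shows "saturation X K \<in> compact_borel_sets X"
proof -
  have K: "K \<subseteq> topspace X"
    using assms by (rule compactin_subset_topspace)
  have sub: "saturation X K \<subseteq> topspace X"
    using K by (simp add: saturation_subset_open_iff)
  have "saturation X K = topspace X \<inter> \<Inter>{U. openin X U \<and> K \<subseteq> U}"
    using sub unfolding saturation_def by blast
  then have "saturated_in X (saturation X K)"
    unfolding saturated_in_def by (intro exI[of _ "{U. openin X U \<and> K \<subseteq> U}"] conjI) simp_all
  moreover have "compactin X (saturation X K)"
    unfolding compactin_def
  proof (intro conjI sub allI impI)
    fix \<U> assume \<U>: "Ball \<U> (openin X) \<and> saturation X K \<subseteq> \<Union>\<U>"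
    then have "K \<subseteq> \<Union>\<U>"
      using subset_saturation[of K X] by auto
    with \<U> obtain \<F> where \<F>: "finite \<F>" "\<F> \<subseteq> \<U>" "K \<subseteq> \<Union>\<F>"
      using compactinD[OF assms, of \<U>] by auto
    \<comment> \<open>A finite subfamily covering \<open>K\<close> has an open union, hence covers
      the saturation as well.\<close>
    then have "openin X (\<Union>\<F>)"
      using \<U> by (intro openin_Union) auto
    then have "saturation X K \<subseteq> \<Union>\<F>"
      using \<F>(3) by (simp only: saturation_subset_open_iff)
    with \<F> show "\<exists>\<F>. finite \<F> \<and> \<F> \<subseteq> \<U> \<and> saturation X K \<subseteq> \<Union>\<F>"
      by (intro exI[of _ \<F>] conjI)
  qed
  ultimately show ?thesis
    unfolding compact_borel_sets_def borel_sets_def by (blast intro: sigma_sets.Basic)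
qed

lemma outer_part_saturation: "outer_part X \<nu> (saturation X K) = outer_part X \<nu> K"
  unfolding outer_part_def
  by (rule arg_cong[where f = Inf]) (auto simp: saturation_subset_open_iff)

section \<open>Maxitive measures and their regular parts\<close>

lemma maxitive_mono:
  assumes "maxitive_measure X \<nu>" "A \<in> borel_sets X" "B \<in> borel_sets X" "A \<subseteq> B"
  shows "\<nu> A \<le> \<nu> B"
proof -
  have "\<nu> (A \<union> B) = sup (\<nu> A) (\<nu> B)"
    using assms by (simp add: maxitive_measure_def)
  with \<open>A \<subseteq> B\<close> show ?thesis
    by (simp add: Un_absorb1 le_iff_sup)
qed

lemma outer_part_le:
  fixes \<nu> :: "'e set \<Rightarrow> 'l::{conditionally_complete_lattice, order_bot}"
  assumes "openin X G" "B \<subseteq> G"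
  shows "outer_part X \<nu> B \<le> \<nu> G"
  unfolding outer_part_def using assms by (intro cINF_lower) auto

text \<open>The whole space is an open superset of every compact set, so its value is a common
  bound.\<close>

lemma bdd_above_regular_part:
  fixes \<nu> :: "'e set \<Rightarrow> 'l::{conditionally_complete_lattice, order_bot}"
  shows "bdd_above (outer_part X \<nu> ` {K \<in> compact_borel_sets X. K \<subseteq> B})"
  by (rule bdd_aboveI[of _ "\<nu> (topspace X)"])
     (auto simp: compact_borel_sets_def dest: compactin_subset_topspace intro!: outer_part_le)

lemma outer_part_le_regular_part:
  fixes \<nu> :: "'e set \<Rightarrow> 'l::{conditionally_complete_lattice, order_bot}"
  assumes "K \<in> compact_borel_sets X" "K \<subseteq> B"
  shows "outer_part X \<nu> K \<le> regular_part X \<nu> B"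
  unfolding regular_part_def using assms by (intro cSUP_upper bdd_above_regular_part) auto

text \<open>The empty compact set keeps the family nonempty, as the conditional supremum
  requires.\<close>

lemma regular_part_least:
  fixes \<nu> :: "'e set \<Rightarrow> 'l::{conditionally_complete_lattice, order_bot}"
  assumes "\<And>K. K \<in> compact_borel_sets X \<Longrightarrow> K \<subseteq> B \<Longrightarrow> outer_part X \<nu> K \<le> u"
  shows "regular_part X \<nu> B \<le> u"
  unfolding regular_part_def using assms empty_compact_borel[of X]
  by (intro cSUP_least) auto

lemma regular_part_mono:
  fixes \<nu> :: "'e set \<Rightarrow> 'l::{conditionally_complete_lattice, order_bot}"
  shows "A \<subseteq> B \<Longrightarrow> regular_part X \<nu> A \<le> regular_part X \<nu> B"
  by (intro regular_part_least outer_part_le_regular_part) auto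

lemma regular_part_le:
  fixes \<nu> :: "'e set \<Rightarrow> 'l::{conditionally_complete_lattice, order_bot}"
  assumes "maxitive_measure X \<nu>" "outer_continuous X \<nu>" "B \<in> borel_sets X"
  shows "regular_part X \<nu> B \<le> \<nu> B"
proof (rule regular_part_least)
  fix K assume "K \<in> compact_borel_sets X" "K \<subseteq> B"
  then show "outer_part X \<nu> K \<le> \<nu> B"
    using assms maxitive_mono[of X \<nu> K B]
    by (auto simp: outer_continuous_def compact_borel_sets_def)
qed

text \<open>The two suprema agree termwise: the saturation of \<open>K\<close> is Borel, so outer
  continuity applies to it, and it has the same open supersets as \<open>K\<close>.\<close>

lemma inner_continuous_iff_regular_part:
  fixes \<nu> :: "'e set \<Rightarrow> 'l::{conditionally_complete_lattice, order_bot}"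
  assumes "outer_continuous X \<nu>"
  shows "inner_continuous X \<nu> \<longleftrightarrow> (\<forall>B\<in>borel_sets X. \<nu> B = regular_part X \<nu> B)"
proof -
  have "\<nu> (saturation X K) = outer_part X \<nu> K" if "K \<in> compact_borel_sets X" for K
    using assms that saturation_compact_borel[of X K] outer_part_saturation[of X \<nu> K]
    by (auto simp: outer_continuous_def compact_borel_sets_def)
  then show ?thesis
    unfolding inner_continuous_def regular_part_def by (simp cong: SUP_cong_simp)
qed

lemma eq_regular_part_if_regular_part_of:
  fixes \<nu> \<mu> :: "'e set \<Rightarrow> 'l::{conditionally_complete_lattice, order_bot}"
  assumes "maxitive_measure X \<nu>" "outer_continuous X \<nu>"
    and \<mu>: "\<And>B. B \<in> borel_sets X \<Longrightarrow> \<nu> B = regular_part X \<mu> B"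
    and "B \<in> borel_sets X"
  shows "\<nu> B = regular_part X \<nu> B"
proof (rule antisym)
  have "regular_part X \<mu> B \<le> regular_part X \<nu> B"
  proof (rule regular_part_least)
    fix K assume K: "K \<in> compact_borel_sets X" "K \<subseteq> B"
    then have KB: "K \<in> borel_sets X"
      by (simp add: compact_borel_sets_def)
    \<comment> \<open>\<open>K\<close> is one of its own compact Borel subsets.\<close>
    have "outer_part X \<mu> K \<le> \<nu> K"
      using K(1) KB by (simp add: \<mu> outer_part_le_regular_part)
    also have "\<nu> K = outer_part X \<nu> K"
      using assms(2) KB by (simp add: outer_continuous_def)
    also have "\<dots> \<le> regular_part X \<nu> B"
      using K by (rule outer_part_le_regular_part)
    finally show "outer_part X \<mu> K \<le> regular_part X \<nu> B" .
  qed
  then show "\<nu> B \<le> regular_part X \<nu> B"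
    using assms by simp
  show "regular_part X \<nu> B \<le> \<nu> B"
    using assms by (intro regular_part_le)
qed

section \<open>The singular part\<close>

lemma singular_part_exists:
  fixes \<nu> :: "'e set \<Rightarrow> 'l::{conditionally_complete_lattice, distrib_lattice, order_bot}"
  assumes cont: "continuous_poset TYPE('l)"
    and max: "maxitive_measure X \<nu>" and outer: "outer_continuous X \<nu>"
  shows "\<exists>\<tau>. is_singular_part X \<nu> \<tau>"
proof -
  \<comment> \<open>\<open>f\<close> need not be monotone, since both terms of the difference grow
    with \<open>B\<close>; the supremum over Borel subsets in \<open>\<tau>\<close> restores
    monotonicity.\<close>
  define f where "f B = lattice_diff (\<nu> B) (regular_part X \<nu> B)" for B
  define \<tau> where "\<tau> B = (SUP C\<in>{C \<in> borel_sets X. C \<subseteq> B}. f C)" for B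
  have f_le_iff: "f B \<le> x \<longleftrightarrow> \<nu> B \<le> sup (regular_part X \<nu> B) x" for B x
    by (simp add: f_def lattice_diff_le_iff[OF cont])
  have f_le: "f B \<le> \<nu> B" for B
    by (simp add: f_le_iff)
  have E: "{} \<in> borel_sets X"
    by (simp add: openin_borel)
  have f_upper: "f C \<le> \<tau> B" if "C \<in> borel_sets X" "C \<subseteq> B" for B C
    unfolding \<tau>_def
  proof (rule cSUP_upper)
    have "f D \<le> \<nu> (topspace X)" if "D \<in> borel_sets X" for D
      using that by (intro order_trans[OF f_le] maxitive_mono[OF max])
        (auto simp: openin_borel dest: borel_subset)
    then show "bdd_above (f ` {C \<in> borel_sets X. C \<subseteq> B})"
      by (intro bdd_aboveI[of _ "\<nu> (topspace X)"]) auto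
  qed (use that in auto)
  have \<tau>_least: "\<tau> B \<le> u" if "\<And>C. C \<in> borel_sets X \<Longrightarrow> C \<subseteq> B \<Longrightarrow> f C \<le> u" for B u
    unfolding \<tau>_def using that E by (intro cSUP_least) auto
  \<comment> \<open>By the adjunction it suffices to bound \<open>\<nu> A\<close> and
    \<open>\<nu> B\<close> separately, each time enlarging the regular part to that of the
    union.\<close>
  have f_Un: "f (A \<union> B) \<le> sup (f A) (f B)"
    if "A \<in> borel_sets X" "B \<in> borel_sets X" for A B
  proof -
    let ?R = "regular_part X \<nu>"
    have bound: "\<nu> C \<le> sup (?R (A \<union> B)) (sup (f A) (f B))"
      if "C \<subseteq> A \<union> B" "f C \<le> sup (f A) (f B)" for C
    proof -
      have "\<nu> C \<le> sup (?R C) (sup (f A) (f B))"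
        using that(2) by (simp add: f_le_iff)
      also have "\<dots> \<le> sup (?R (A \<union> B)) (sup (f A) (f B))"
        using that(1) by (intro sup_mono regular_part_mono order_refl)
      finally show ?thesis .
    qed
    have "sup (\<nu> A) (\<nu> B) \<le> sup (?R (A \<union> B)) (sup (f A) (f B))"
      by (intro sup_least bound) auto
    then show ?thesis
      using max that by (simp add: f_le_iff maxitive_measure_def)
  qed
  have "maxitive_measure X \<tau>"
    unfolding maxitive_measure_def
  proof (intro conjI ballI)
    have "f {} \<le> bot"
      using f_le[of "{}"] max by (simp add: maxitive_measure_def)
    then have "\<tau> {} \<le> bot"
      by (intro \<tau>_least) auto
    then show "\<tau> {} = bot"
      by (simp add: bot_unique)
  next
    fix A B assume AB: "A \<in> borel_sets X" "B \<in> borel_sets X"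
    show "\<tau> (A \<union> B) = sup (\<tau> A) (\<tau> B)"
    proof (rule antisym)
      show "\<tau> (A \<union> B) \<le> sup (\<tau> A) (\<tau> B)"
      proof (rule \<tau>_least)
        fix C assume C: "C \<in> borel_sets X" "C \<subseteq> A \<union> B"
        \<comment> \<open>Cutting \<open>C\<close> along \<open>A\<close> and \<open>B\<close> turns
          subadditivity of \<open>f\<close> into maxitivity of \<open>\<tau>\<close>.\<close>
        then have "C = (C \<inter> A) \<union> (C \<inter> B)"
          by blast
        then have "f C \<le> sup (f (C \<inter> A)) (f (C \<inter> B))"
          using f_Un[of "C \<inter> A" "C \<inter> B"] AB C by (simp add: borel_Int)
        also have "\<dots> \<le> sup (\<tau> A) (\<tau> B)"
          using AB C by (intro sup_mono f_upper borel_Int) auto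
        finally show "f C \<le> sup (\<tau> A) (\<tau> B)" .
      qed
      show "sup (\<tau> A) (\<tau> B) \<le> \<tau> (A \<union> B)"
        by (intro sup_least \<tau>_least f_upper) auto
    qed
  qed
  moreover have "outer_part X \<nu> B = sup (regular_part X \<nu> B) (\<tau> B)"
    if B: "B \<in> borel_sets X" for B
  proof -
    \<comment> \<open>\<open>B\<close> itself competes in the supremum defining
      \<open>\<tau> B\<close>.\<close>
    have "\<nu> B \<le> sup (regular_part X \<nu> B) (\<tau> B)"
      using f_upper[OF B] by (simp add: f_le_iff[symmetric])
    moreover have "\<tau> B \<le> \<nu> B"
      using B by (intro \<tau>_least order_trans[OF f_le] maxitive_mono[OF max]) auto
    ultimately show ?thesis
      using B outer regular_part_le[OF max outer B]
      by (auto simp: outer_continuous_def intro!: antisym)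
  qed
  \<comment> \<open>Any complement dominates \<open>f\<close> pointwise by the adjunction and, being
    monotone, dominates the hull.\<close>
  moreover have "\<tau> B \<le> \<sigma> B" if \<sigma>: "singular_complement X \<nu> \<sigma>" and B: "B \<in> borel_sets X" for \<sigma> B
  proof (rule \<tau>_least)
    fix C assume C: "C \<in> borel_sets X" "C \<subseteq> B"
    then have "f C \<le> \<sigma> C"
      using \<sigma> outer by (auto simp: f_le_iff singular_complement_def outer_continuous_def)
    also have "\<dots> \<le> \<sigma> B"
      using \<sigma> B C maxitive_mono[of X \<sigma> C B] by (simp add: singular_complement_def)
    finally show "f C \<le> \<sigma> B" .
  qed
  ultimately have "is_singular_part X \<nu> \<tau>"
    unfolding is_singular_part_def singular_complement_def[of X \<nu> \<tau>] by simp
  then show ?thesis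
    by (rule exI[of _ \<tau>])
qed

text \<open>The singular part is itself a complement, so if it vanishes then \<open>\<nu>\<close> is
  its regular part; conversely the zero map becomes a complement, and leastness applies.\<close>

lemma singular_part_bot_iff:
  fixes \<nu> :: "'e set \<Rightarrow> 'l::{conditionally_complete_lattice, distrib_lattice, order_bot}"
  assumes "continuous_poset TYPE('l)"
    and "maxitive_measure X \<nu>" and outer: "outer_continuous X \<nu>"
  shows "(\<forall>B\<in>borel_sets X. singular_part X \<nu> B = bot) \<longleftrightarrow>
    (\<forall>B\<in>borel_sets X. \<nu> B = regular_part X \<nu> B)"
proof -
  have sing: "is_singular_part X \<nu> (singular_part X \<nu>)"
    unfolding singular_part_def using singular_part_exists[OF assms] by (rule someI_ex)
  show ?thesis
  proof (intro iffI ballI)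
    fix B assume "\<forall>B\<in>borel_sets X. singular_part X \<nu> B = bot" "B \<in> borel_sets X"
    then show "\<nu> B = regular_part X \<nu> B"
      using sing outer
      by (auto simp: is_singular_part_def singular_complement_def outer_continuous_def sup_absorb1)
  next
    fix B assume eq: "\<forall>B\<in>borel_sets X. \<nu> B = regular_part X \<nu> B" and B: "B \<in> borel_sets X"
    have "singular_complement X \<nu> (\<lambda>_. bot)"
      using eq outer
      by (auto simp: singular_complement_def maxitive_measure_def outer_continuous_def sup_absorb1)
    then show "singular_part X \<nu> B = bot"
      using sing B by (auto simp: is_singular_part_def bot_unique)
  qed
qed

theorem corollary5p4:
  fixes X :: "'e topology"
    and \<nu> :: "'e set \<Rightarrow> 'l::{conditionally_complete_lattice, distrib_lattice, order_bot}"
  assumes "continuous_poset TYPE('l)"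
    and "quasisober X"
    and "maxitive_measure X \<nu>"
    and "outer_continuous X \<nu>"
  shows "((\<exists>\<mu> :: 'e set \<Rightarrow> 'l. maxitive_measure X \<mu> \<and>
              (\<forall>B\<in>borel_sets X. \<nu> B = regular_part X \<mu> B))
            \<longleftrightarrow> (\<forall>B\<in>borel_sets X. singular_part X \<nu> B = bot))
       \<and> ((\<forall>B\<in>borel_sets X. singular_part X \<nu> B = bot) \<longleftrightarrow> regular_measure X \<nu>)"
proof -
  \<comment> \<open>If \<open>\<nu>\<close> equals its own regular part, then \<open>\<nu>\<close>
    serves as the witness \<open>\<mu>\<close>.\<close>
  have "(\<exists>\<mu> :: 'e set \<Rightarrow> 'l. maxitive_measure X \<mu> \<and>
            (\<forall>B\<in>borel_sets X. \<nu> B = regular_part X \<mu> B))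
          \<longleftrightarrow> (\<forall>B\<in>borel_sets X. \<nu> B = regular_part X \<nu> B)"
    using assms(3) eq_regular_part_if_regular_part_of[OF assms(3,4)] by metis
  then show ?thesis
    using singular_part_bot_iff[OF assms(1,3,4)] inner_continuous_iff_regular_part[OF assms(4)]
      assms(4)
    by (simp add: regular_measure_def)
qed

end
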